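(* Let $\mathcal{B}$ be a finite structure with domain $B$ and let $C\subseteq B$ be nonempty. The following are equivalent. (i) $\mathcal{B}$ is $0$-collapsible from source $C$. (ii) For some (equivalently, for every) $|C|$-tuple $x$ whose entries are all the elements of $C$, the power $\mathcal{B}^{|C|}$ is $0$-collapsible from the singleton source $\{x\}$.
   Context: A pH-sentence is a prenex first-order sentence using only $\exists,\forall,\wedge$ over atoms. For a structure $\mathcal{D}$ with domain $D$ and $S\subseteq D$, $\mathcal{D}$ is $0$-collapsible from source $S$ if for every pH-sentence $\phi$: whenever, for every $s\in S$, $\mathcal{D}$ satisfies $\phi$ with all universally quantified variables restricted to range over $\{s\}$ (equivalently, all universal variables instantiated to $s$), then $\mathcal{D}\models\phi$. The power $\mathcal{B}^k$ has domain $B^k$ and a relation holds on a tuple of $k$-tuples iff it holds in $\mathcal{B}$ in each coordinate. *)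

theory Defs
  imports Main "HOL-Library.NList"
begin

text \<open>A relational signature is a partial map from symbols to arities; its domain is the set of
  relation symbols, so the empty signature is covered as well.\<close>

type_synonym 'r signature = "'r \<Rightarrow> nat option"

record ('a, 'r) rel_structure =
  universe :: "'a set"
  rel :: "'r \<Rightarrow> 'a list set"

definition is_structure :: "'r signature \<Rightarrow> ('a, 'r) rel_structure \<Rightarrow> bool" where
  "is_structure \<sigma> \<D> \<longleftrightarrow> universe \<D> \<noteq> {} \<and>
     (\<forall>R. \<forall>t \<in> rel \<D> R. \<sigma> R = Some (length t) \<and> set t \<subseteq> universe \<D>)"

text \<open>Atoms are applications of relation symbols to variables. Equality is not a logical
  symbol: the sentence \<open>\<forall>x. \<forall>y. x = y\<close> would otherwise refute 0-collapsibility of every structure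
  with at least two elements. A structure may still interpret some binary symbol as equality.\<close>

datatype 'r matrix =
    Atom 'r "nat list"
  | And "'r matrix" "'r matrix"

text \<open>Prenex form is built into the type: quantifiers occur only in front of a matrix.\<close>

datatype 'r pH =
    Matrix "'r matrix"
  | Exists nat "'r pH"
  | Forall nat "'r pH"

primrec wf_matrix :: "'r signature \<Rightarrow> 'r matrix \<Rightarrow> bool" where
  "wf_matrix \<sigma> (Atom R xs) \<longleftrightarrow> \<sigma> R = Some (length xs)"
| "wf_matrix \<sigma> (And \<alpha> \<beta>) \<longleftrightarrow> wf_matrix \<sigma> \<alpha> \<and> wf_matrix \<sigma> \<beta>"

primrec wf_pH :: "'r signature \<Rightarrow> 'r pH \<Rightarrow> bool" where
  "wf_pH \<sigma> (Matrix \<alpha>) \<longleftrightarrow> wf_matrix \<sigma> \<alpha>"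
| "wf_pH \<sigma> (Exists v \<phi>) \<longleftrightarrow> wf_pH \<sigma> \<phi>"
| "wf_pH \<sigma> (Forall v \<phi>) \<longleftrightarrow> wf_pH \<sigma> \<phi>"

primrec matrix_vars :: "'r matrix \<Rightarrow> nat set" where
  "matrix_vars (Atom R xs) = set xs"
| "matrix_vars (And \<alpha> \<beta>) = matrix_vars \<alpha> \<union> matrix_vars \<beta>"

primrec free_vars :: "'r pH \<Rightarrow> nat set" where
  "free_vars (Matrix \<alpha>) = matrix_vars \<alpha>"
| "free_vars (Exists v \<phi>) = free_vars \<phi> - {v}"
| "free_vars (Forall v \<phi>) = free_vars \<phi> - {v}"

definition pH_sentence :: "'r signature \<Rightarrow> 'r pH \<Rightarrow> bool" where
  "pH_sentence \<sigma> \<phi> \<longleftrightarrow> wf_pH \<sigma> \<phi> \<and> free_vars \<phi> = {}"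

primrec sat_matrix :: "('a, 'r) rel_structure \<Rightarrow> (nat \<Rightarrow> 'a) \<Rightarrow> 'r matrix \<Rightarrow> bool" where
  "sat_matrix \<D> e (Atom R xs) \<longleftrightarrow> map e xs \<in> rel \<D> R"
| "sat_matrix \<D> e (And \<alpha> \<beta>) \<longleftrightarrow> sat_matrix \<D> e \<alpha> \<and> sat_matrix \<D> e \<beta>"

text \<open>In \<open>sat \<D> U e \<phi>\<close> the universal variables range over \<open>U\<close> and the existential ones over the
  whole universe; \<open>U = universe \<D>\<close> gives ordinary satisfaction.\<close>

primrec sat :: "('a, 'r) rel_structure \<Rightarrow> 'a set \<Rightarrow> (nat \<Rightarrow> 'a) \<Rightarrow> 'r pH \<Rightarrow> bool" where
  "sat \<D> U e (Matrix \<alpha>) \<longleftrightarrow> sat_matrix \<D> e \<alpha>"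
| "sat \<D> U e (Exists v \<phi>) \<longleftrightarrow> (\<exists>a \<in> universe \<D>. sat \<D> U (e(v := a)) \<phi>)"
| "sat \<D> U e (Forall v \<phi>) \<longleftrightarrow> (\<forall>a \<in> U. sat \<D> U (e(v := a)) \<phi>)"

text \<open>For a sentence the truth value does not depend on the assignment.\<close>

definition models_on :: "('a, 'r) rel_structure \<Rightarrow> 'a set \<Rightarrow> 'r pH \<Rightarrow> bool" where
  "models_on \<D> U \<phi> \<longleftrightarrow> (\<forall>e. range e \<subseteq> universe \<D> \<longrightarrow> sat \<D> U e \<phi>)"

definition models :: "('a, 'r) rel_structure \<Rightarrow> 'r pH \<Rightarrow> bool" where
  "models \<D> \<phi> \<longleftrightarrow> models_on \<D> (universe \<D>) \<phi>"

definition zero_collapsible :: "'r signature \<Rightarrow> ('a, 'r) rel_structure \<Rightarrow> 'a set \<Rightarrow> bool" where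
  "zero_collapsible \<sigma> \<D> S \<longleftrightarrow>
     (\<forall>\<phi>. pH_sentence \<sigma> \<phi> \<longrightarrow> (\<forall>s \<in> S. models_on \<D> {s} \<phi>) \<longrightarrow> models \<D> \<phi>)"

text \<open>The \<open>k\<close>-th power; \<open>k\<close>-tuples are lists of length \<open>k\<close>. Only \<open>k \<ge> 1\<close> is meaningful here, since
  for \<open>k = 0\<close> the arities of the relations are lost.\<close>

definition power_structure :: "nat \<Rightarrow> ('a, 'r) rel_structure \<Rightarrow> ('a list, 'r) rel_structure" where
  "power_structure k \<D> =
     \<lparr> universe = nlists k (universe \<D>),
       rel = (\<lambda>R. {ts. set ts \<subseteq> nlists k (universe \<D>) \<and>
                       (\<forall>i < k. map (\<lambda>t. t ! i) ts \<in> rel \<D> R)}) \<rparr>"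

end

theory Submission
  imports Defs
begin

text \<open>An existential player in the power plays the coordinates independently, so for universal
  variables ranging over a box \<open>U 0 \<times> \<dots> \<times> U (k - 1)\<close> a sentence holds in the power iff it holds in
  the base structure over every side \<open>U i\<close>. The whole power is the box with all sides the whole
  universe, and \<open>{x}\<close> is the box with sides \<open>{x ! i}\<close>; hence collapsibility of the power from \<open>{x}\<close>
  is collapsibility of the base from the set of entries of \<open>x\<close>.\<close>

definition box :: "nat \<Rightarrow> (nat \<Rightarrow> 'a set) \<Rightarrow> 'a list set" where
  "box k U = {t. length t = k \<and> (\<forall>i < k. t ! i \<in> U i)}"

lemma box_const: "box k (\<lambda>_. A) = nlists k A"
  unfolding box_def nlists_def subset_eq all_set_conv_all_nth
  by (intro Collect_cong) auto

lemma box_singleton: "length x = k \<Longrightarrow> box k (\<lambda>i. {x ! i}) = {x}"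
  by (auto simp: box_def list_eq_iff_nth_eq)

lemma box_mono: "(\<And>i. i < k \<Longrightarrow> U i \<subseteq> V i) \<Longrightarrow> box k U \<subseteq> box k V"
  by (auto simp: box_def)

text \<open>Entries of a tuple can be chosen independently, so one witness per coordinate assembles
  into a single tuple. This is the existential step in the induction on formulas.\<close>

lemma ex_box_iff: "(\<exists>t \<in> box k U. \<forall>i < k. P i (t ! i)) \<longleftrightarrow> (\<forall>i < k. \<exists>a \<in> U i. P i a)"
proof
  assume "\<forall>i < k. \<exists>a \<in> U i. P i a"
  then obtain f where "\<forall>i < k. f i \<in> U i \<and> P i (f i)"
    by metis
  then show "\<exists>t \<in> box k U. \<forall>i < k. P i (t ! i)"
    by (intro bexI[of _ "map f [0..<k]"]) (auto simp: box_def)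
qed (auto simp: box_def)

text \<open>The universal step. Nonempty sides ensure that any value at one coordinate extends to a
  full tuple; an empty side would make the box empty and the left-hand side vacuous.\<close>

lemma all_box_iff:
  assumes "\<And>i. i < k \<Longrightarrow> U i \<noteq> {}"
  shows "(\<forall>t \<in> box k U. \<forall>i < k. P i (t ! i)) \<longleftrightarrow> (\<forall>i < k. \<forall>a \<in> U i. P i a)"
proof (intro iffI allI impI ballI)
  fix i a
  assume all: "\<forall>t \<in> box k U. \<forall>i < k. P i (t ! i)" and i: "i < k" and a: "a \<in> U i"
  \<comment> \<open>Prescribe \<open>a\<close> at coordinate \<open>i\<close> and leave every other
    coordinate free; \<open>ex_box_iff\<close> turns this into a tuple of the box.\<close>
  have "\<forall>j < k. \<exists>b \<in> U j. j = i \<longrightarrow> b = a"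
    using assms a by blast
  then obtain t where "t \<in> box k U" "\<forall>j < k. j = i \<longrightarrow> t ! j = a"
    using ex_box_iff[of k U "\<lambda>j b. j = i \<longrightarrow> b = a"] by blast
  then show "P i a"
    using all i by auto
qed (auto simp: box_def)

lemma universe_power_structure [simp]:
  "universe (power_structure k \<D>) = nlists k (universe \<D>)"
  by (simp add: power_structure_def)

lemma nth_fun_upd: "(\<lambda>w. (e(v := t)) w ! i) = (\<lambda>w. e w ! i)(v := t ! i)"
  by auto

text \<open>The range assumption settles the membership condition built into the relations of the
  power, leaving only the coordinatewise condition.\<close>

lemma sat_matrix_power_structure:
  assumes "range e \<subseteq> nlists k (universe \<D>)"
  shows "sat_matrix (power_structure k \<D>) e \<alpha> \<longleftrightarrow> (\<forall>i < k. sat_matrix \<D> (\<lambda>v. e v ! i) \<alpha>)"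
proof (induction \<alpha>)
  case (Atom R xs)
  then show ?case
    using assms by (auto simp: power_structure_def comp_def)
qed auto

text \<open>Induction on the formula, with the assignment generalized because quantifiers update it.
  Existential variables range over the box with all sides \<open>universe \<D>\<close>, universal
  ones over \<open>box k U\<close>; the sides lie in the universe, so updated assignments stay in
  the power.\<close>

lemma sat_power_structure:
  assumes "range e \<subseteq> nlists k (universe \<D>)"
    and "\<And>i. i < k \<Longrightarrow> U i \<noteq> {}" and "\<And>i. i < k \<Longrightarrow> U i \<subseteq> universe \<D>"
  shows "sat (power_structure k \<D>) (box k U) e \<phi> \<longleftrightarrow> (\<forall>i < k. sat \<D> (U i) (\<lambda>v. e v ! i) \<phi>)"
  using assms(1)
proof (induction \<phi> arbitrary: e)
  case (Matrix \<alpha>)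
  then show ?case
    by (simp add: sat_matrix_power_structure)
next
  case (Exists v \<phi>)
  have "sat (power_structure k \<D>) (box k U) (e(v := t)) \<phi> \<longleftrightarrow>
      (\<forall>i < k. sat \<D> (U i) ((\<lambda>w. e w ! i)(v := t ! i)) \<phi>)"
    if "t \<in> nlists k (universe \<D>)" for t
  proof -
    have "range (e(v := t)) \<subseteq> nlists k (universe \<D>)"
      using Exists.prems that by auto
    from Exists.IH[OF this] show ?thesis
      by (simp only: nth_fun_upd)
  qed
  then show ?case
    using ex_box_iff[of k "\<lambda>_. universe \<D>" "\<lambda>i a. sat \<D> (U i) ((\<lambda>w. e w ! i)(v := a)) \<phi>"]
    by (simp add: box_const)
next
  case (Forall v \<phi>)
  have box: "box k U \<subseteq> nlists k (universe \<D>)"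
    using box_mono[of k U "\<lambda>_. universe \<D>"] assms(3) by (simp add: box_const)
  have "sat (power_structure k \<D>) (box k U) (e(v := t)) \<phi> \<longleftrightarrow>
      (\<forall>i < k. sat \<D> (U i) ((\<lambda>w. e w ! i)(v := t ! i)) \<phi>)"
    if "t \<in> box k U" for t
  proof -
    have "range (e(v := t)) \<subseteq> nlists k (universe \<D>)"
      using Forall.prems that box by auto
    from Forall.IH[OF this] show ?thesis
      by (simp only: nth_fun_upd)
  qed
  then show ?case
    using all_box_iff[OF assms(2), where P = "\<lambda>i a. sat \<D> (U i) ((\<lambda>w. e w ! i)(v := a)) \<phi>"]
    by simp
qed

lemma models_on_power_structure:
  assumes "\<And>i. i < k \<Longrightarrow> U i \<noteq> {}" and "\<And>i. i < k \<Longrightarrow> U i \<subseteq> universe \<D>"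
  shows "models_on (power_structure k \<D>) (box k U) \<phi> \<longleftrightarrow> (\<forall>i < k. models_on \<D> (U i) \<phi>)"
proof (intro iffI allI impI)
  fix i
  assume power: "models_on (power_structure k \<D>) (box k U) \<phi>" and i: "i < k"
  show "models_on \<D> (U i) \<phi>"
    unfolding models_on_def
  proof (intro allI impI)
    fix e :: "nat \<Rightarrow> 'a"
    assume "range e \<subseteq> universe \<D>"
    \<comment> \<open>Constant tuples lift an assignment of the base to the power, and every
      projection gives \<open>e\<close> back.\<close>
    then have diag: "range (\<lambda>v. replicate k (e v)) \<subseteq> nlists k (universe \<D>)"
      by auto
    then have "sat (power_structure k \<D>) (box k U) (\<lambda>v. replicate k (e v)) \<phi>"
      using power unfolding models_on_def universe_power_structure by blast
    then have "sat \<D> (U i) (\<lambda>v. replicate k (e v) ! i) \<phi>"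
      using i sat_power_structure[where U = U, OF diag assms] by blast
    then show "sat \<D> (U i) e \<phi>"
      using i by simp
  qed
next
  assume factors: "\<forall>i < k. models_on \<D> (U i) \<phi>"
  show "models_on (power_structure k \<D>) (box k U) \<phi>"
    unfolding models_on_def
  proof (intro allI impI)
    fix e :: "nat \<Rightarrow> 'a list"
    assume "range e \<subseteq> universe (power_structure k \<D>)"
    then have e: "range e \<subseteq> nlists k (universe \<D>)"
      by simp
    then have "e v ! i \<in> universe \<D>" if "i < k" for v i
      using that by (meson nlistsE_nth_in rangeI subsetD)
    then have "\<forall>i < k. sat \<D> (U i) (\<lambda>v. e v ! i) \<phi>"
      using factors unfolding models_on_def by (simp add: image_subset_iff)
    then show "sat (power_structure k \<D>) (box k U) e \<phi>"
      using sat_power_structure[where U = U, OF e assms] by blast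
  qed
qed

text \<open>Both the hypothesis and the conclusion of collapsibility transfer sentence by sentence.
  Repeated entries of \<open>x\<close> are harmless, since only its set of entries matters.\<close>

lemma zero_collapsible_power_structure:
  assumes "set x \<subseteq> universe \<D>" and "x \<noteq> []"
  shows "zero_collapsible \<sigma> (power_structure (length x) \<D>) {x} \<longleftrightarrow> zero_collapsible \<sigma> \<D> (set x)"
proof -
  have "universe \<D> \<noteq> {}"
    using assms by auto
  \<comment> \<open>All coordinates impose the same condition \<open>models \<D> \<phi>\<close>, and
    \<open>x \<noteq> []\<close> guarantees at least one coordinate.\<close>
  then have "models (power_structure (length x) \<D>) \<phi> \<longleftrightarrow> models \<D> \<phi>" for \<phi>
    using models_on_power_structure[of "length x" "\<lambda>_. universe \<D>" \<D> \<phi>] assms(2)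
    by (auto simp: models_def box_const)
  moreover have "models_on (power_structure (length x) \<D>) {x} \<phi> \<longleftrightarrow> (\<forall>s \<in> set x. models_on \<D> {s} \<phi>)"
    for \<phi>
    using models_on_power_structure[of "length x" "\<lambda>i. {x ! i}" \<D> \<phi>] assms(1)
    by (auto simp: box_singleton all_set_conv_all_nth subset_iff)
  ultimately show ?thesis
    by (simp add: zero_collapsible_def)
qed

theorem theorem10:
  fixes \<sigma> :: "'r signature" and \<B> :: "('a, 'r) rel_structure" and C :: "'a set"
  assumes "is_structure \<sigma> \<B>"
    and "finite (universe \<B>)"
    and "C \<subseteq> universe \<B>"
    and "C \<noteq> {}"
  shows "(zero_collapsible \<sigma> \<B> C \<longleftrightarrow>
            (\<exists>x. length x = card C \<and> set x = C \<and>
                 zero_collapsible \<sigma> (power_structure (card C) \<B>) {x}))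
       \<and> (zero_collapsible \<sigma> \<B> C \<longleftrightarrow>
            (\<forall>x. length x = card C \<and> set x = C \<longrightarrow>
                 zero_collapsible \<sigma> (power_structure (card C) \<B>) {x}))"
proof -
  have "finite C"
    using assms(2,3) finite_subset by blast
  \<comment> \<open>An enumeration of \<open>C\<close> exists, so the universal form is not vacuous
    and the existential form has a witness.\<close>
  then obtain y where "length y = card C" "set y = C"
    using finite_distinct_list distinct_card by metis
  moreover have "zero_collapsible \<sigma> (power_structure (card C) \<B>) {x} \<longleftrightarrow> zero_collapsible \<sigma> \<B> C"
    if "length x = card C" "set x = C" for x
    using that zero_collapsible_power_structure[of x \<B> \<sigma>] assms(3,4) by auto
  ultimately show ?thesis
    by blast
qed

end
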